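(* Let $X$ be a compact Hausdorff space. If the multiplication map $\mu_{OS}X:OS(OS(X))\to OS(X)$ of the monad $\mathbb{OS}$ is soft, then $X$ is metrizable.
   Context: For a compactum $X$, $OS(X)$ is the subspace of $\prod_{\varphi\in C(X)}[\min\varphi,\max\varphi]$ (product topology) consisting of functionals $\nu:C(X)\to\mathbb{R}$ that are normed ($\nu(1_X)=1$), weakly additive ($\nu(\varphi+c_X)=\nu(\varphi)+c$ for constants $c$), order-preserving ($\varphi\le\psi\Rightarrow\nu(\varphi)\le\nu(\psi)$), positively homogeneous ($\nu(t\varphi)=t\nu(\varphi)$, $t\ge0$) and semiadditive ($\nu(\varphi+\psi)\le\nu(\varphi)+\nu(\psi)$); for $f:X\to Y$, $OS(f)(\nu)(\varphi)=\nu(\varphi\circ f)$. The multiplication $\mu_{OS}X:OS(OS(X))\to OS(X)$ is $\mu_{OS}X(\nu)(\varphi)=\nu(\pi_\varphi)$, where $\pi_\varphi:OS(X)\to\mathbb{R}$, $\pi_\varphi(\lambda)=\lambda(\varphi)$. A map $f:X\to Y$ of compacta is soft if for every compactum $Z$, closed $A\subset Z$, and maps $\psi:A\to X$, $\Psi:Z\to Y$ with $\Psi|_A=f\circ\psi$, there is a map $G:Z\to X$ with $G|_A=\psi$ and $f\circ G=\Psi$. *)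

theory Defs
  imports "HOL-Analysis.Analysis"
begin

definition compactum :: "'a topology \<Rightarrow> bool" where
  "compactum X \<longleftrightarrow> compact_space X \<and> Hausdorff_space X"

definition CX :: "'a topology \<Rightarrow> ('a \<Rightarrow> real) set" where
  "CX X = {\<phi>. continuous_map X euclideanreal \<phi> \<and> \<phi> \<in> extensional (topspace X)}"

definition constX :: "'a topology \<Rightarrow> real \<Rightarrow> ('a \<Rightarrow> real)" where
  "constX X c = restrict (\<lambda>_. c) (topspace X)"

definition addX :: "'a topology \<Rightarrow> ('a \<Rightarrow> real) \<Rightarrow> ('a \<Rightarrow> real) \<Rightarrow> ('a \<Rightarrow> real)" where
  "addX X \<phi> \<psi> = restrict (\<lambda>x. \<phi> x + \<psi> x) (topspace X)"

definition scaleX :: "'a topology \<Rightarrow> real \<Rightarrow> ('a \<Rightarrow> real) \<Rightarrow> ('a \<Rightarrow> real)" where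
  "scaleX X t \<phi> = restrict (\<lambda>x. t * \<phi> x) (topspace X)"

definition OS_set :: "'a topology \<Rightarrow> (('a \<Rightarrow> real) \<Rightarrow> real) set" where
  "OS_set X = {\<nu>. \<nu> \<in> extensional (CX X)
     \<and> (\<forall>\<phi>\<in>CX X. Inf (\<phi> ` topspace X) \<le> \<nu> \<phi> \<and> \<nu> \<phi> \<le> Sup (\<phi> ` topspace X))
     \<and> \<nu> (constX X 1) = 1
     \<and> (\<forall>\<phi>\<in>CX X. \<forall>c. \<nu> (addX X \<phi> (constX X c)) = \<nu> \<phi> + c)
     \<and> (\<forall>\<phi>\<in>CX X. \<forall>\<psi>\<in>CX X. (\<forall>x\<in>topspace X. \<phi> x \<le> \<psi> x) \<longrightarrow> \<nu> \<phi> \<le> \<nu> \<psi>)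
     \<and> (\<forall>\<phi>\<in>CX X. \<forall>t\<ge>0. \<nu> (scaleX X t \<phi>) = t * \<nu> \<phi>)
     \<and> (\<forall>\<phi>\<in>CX X. \<forall>\<psi>\<in>CX X. \<nu> (addX X \<phi> \<psi>) \<le> \<nu> \<phi> + \<nu> \<psi>)}"

definition OS :: "'a topology \<Rightarrow> (('a \<Rightarrow> real) \<Rightarrow> real) topology" where
  "OS X = subtopology
     (product_topology (\<lambda>\<phi>. subtopology euclideanreal
         {Inf (\<phi> ` topspace X) .. Sup (\<phi> ` topspace X)}) (CX X))
     (OS_set X)"

definition muOS :: "'a topology \<Rightarrow> (((('a \<Rightarrow> real) \<Rightarrow> real) \<Rightarrow> real) \<Rightarrow> real)
                     \<Rightarrow> (('a \<Rightarrow> real) \<Rightarrow> real)" where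
  "muOS X \<nu> = restrict (\<lambda>\<phi>. \<nu> (restrict (\<lambda>l. l \<phi>) (topspace (OS X)))) (CX X)"

text \<open>Softness of f : X -> Y, with test compacta Z ranging over all compacta whose
  points lie in the type 'z (given by the first argument).\<close>
definition soft :: "'z itself \<Rightarrow> 'a topology \<Rightarrow> 'b topology \<Rightarrow> ('a \<Rightarrow> 'b) \<Rightarrow> bool" where
  "soft _ X Y f \<longleftrightarrow>
    (\<forall>(Z::'z topology) A \<psi> \<Psi>. compactum Z \<and> closedin Z A
       \<and> continuous_map (subtopology Z A) X \<psi> \<and> continuous_map Z Y \<Psi>
       \<and> (\<forall>a\<in>A. \<Psi> a = f (\<psi> a))
       \<longrightarrow> (\<exists>G. continuous_map Z X G \<and> (\<forall>a\<in>A. G a = \<psi> a)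
               \<and> (\<forall>z\<in>topspace Z. f (G z) = \<Psi> z)))"

end

theory Submission
  imports Defs
begin

text \<open>
  Softness forces every point of \<open>X\<close> to be isolated. Identify elements of \<open>OS X\<close> with closed convex
  sets of probability measures. For \<open>x \<noteq> y\<close> the segment from \<open>\<delta>\<^sub>x\<close> to \<open>(\<delta>\<^sub>z + \<delta>\<^sub>y)/2\<close> depends
  continuously on \<open>z\<close>. At \<open>z = x\<close> it is the Minkowski average of \<open>{\<delta>\<^sub>x}\<close> and the segment
  from \<open>\<delta>\<^sub>x\<close> to \<open>\<delta>\<^sub>y\<close>, which is a point \<open>N\<close> of the fibre of the multiplication. A lift \<open>G\<close> of
  this family to \<open>OS (OS X)\<close> with \<open>G x = N\<close> would be discontinuous at \<open>x\<close> unless \<open>x\<close> is isolated: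
  for \<open>z \<noteq> x\<close> near \<open>x\<close> the segment is no longer such an average, and a single continuous
  function \<open>q\<close> on \<open>OS X\<close> detects this, as \<open>G z q \<ge> h z - 1\<close> while \<open>N q = -1/2\<close>,
  where \<open>h\<close> is a Urysohn function with \<open>h x = 1\<close> and \<open>h y = 0\<close>.
\<close>

section \<open>Continuous functions on \<open>X\<close> and their bounds\<close>

lemma restrict_in_CX:
  "continuous_map X euclideanreal \<phi> \<Longrightarrow> restrict \<phi> (topspace X) \<in> CX X"
  by (auto simp: CX_def intro: continuous_map_eq)

lemma constX_in_CX: "constX X c \<in> CX X"
  unfolding constX_def by (intro restrict_in_CX) auto

lemma addX_in_CX: "\<lbrakk>\<phi> \<in> CX X; \<psi> \<in> CX X\<rbrakk> \<Longrightarrow> addX X \<phi> \<psi> \<in> CX X"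
  unfolding addX_def by (intro restrict_in_CX continuous_intros) (auto simp: CX_def)

lemma scaleX_in_CX: "\<phi> \<in> CX X \<Longrightarrow> scaleX X t \<phi> \<in> CX X"
  unfolding scaleX_def by (intro restrict_in_CX continuous_intros) (auto simp: CX_def)

text \<open>Real \<open>Inf\<close> and \<open>Sup\<close> are genuine bounds only for bounded sets;
  the image of a compact space is bounded. This is what places \<open>dirac\<close> inside the
  intervals of \<open>OS_set\<close>.\<close>

lemma CX_bounds:
  assumes "compact_space X" "\<phi> \<in> CX X" "x \<in> topspace X"
  shows "Inf (\<phi> ` topspace X) \<le> \<phi> x" "\<phi> x \<le> Sup (\<phi> ` topspace X)"
proof -
  have "compactin euclideanreal (\<phi> ` topspace X)"
    using assms by (intro image_compactin) (auto simp: CX_def compact_space_def)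
  then have "bounded (\<phi> ` topspace X)"
    by (simp add: compact_imp_bounded)
  then show "Inf (\<phi> ` topspace X) \<le> \<phi> x" "\<phi> x \<le> Sup (\<phi> ` topspace X)"
    using assms by (auto intro!: cInf_lower cSup_upper bounded_imp_bdd_below bounded_imp_bdd_above)
qed

section \<open>The topology of \<open>OS X\<close> and its compactness\<close>

lemma OS_setD:
  assumes "\<nu> \<in> OS_set X"
  shows "\<nu> (constX X 1) = 1"
    and "\<phi> \<in> CX X \<Longrightarrow> \<nu> (addX X \<phi> (constX X c)) = \<nu> \<phi> + c"
    and "\<lbrakk>\<phi> \<in> CX X; \<psi> \<in> CX X; \<And>x. x \<in> topspace X \<Longrightarrow> \<phi> x \<le> \<psi> x\<rbrakk> \<Longrightarrow> \<nu> \<phi> \<le> \<nu> \<psi>"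
    and "\<lbrakk>\<phi> \<in> CX X; t \<ge> 0\<rbrakk> \<Longrightarrow> \<nu> (scaleX X t \<phi>) = t * \<nu> \<phi>"
    and "\<lbrakk>\<phi> \<in> CX X; \<psi> \<in> CX X\<rbrakk> \<Longrightarrow> \<nu> (addX X \<phi> \<psi>) \<le> \<nu> \<phi> + \<nu> \<psi>"
  using assms by (auto simp: OS_set_def)

lemma topspace_OS: "topspace (OS X) = OS_set X"
proof -
  have "OS_set X \<subseteq> (\<Pi>\<^sub>E \<phi>\<in>CX X. {Inf (\<phi> ` topspace X) .. Sup (\<phi> ` topspace X)})"
    unfolding OS_set_def by (rule subsetI) (simp add: PiE_iff)
  then show ?thesis
    by (simp add: OS_def inf.absorb2)
qed

lemma continuous_map_into_OS:
  assumes "\<And>z. z \<in> topspace Z \<Longrightarrow> f z \<in> OS_set X"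
    and "\<And>\<phi>. \<phi> \<in> CX X \<Longrightarrow> continuous_map Z euclideanreal (\<lambda>z. f z \<phi>)"
  shows "continuous_map Z (OS X) f"
  unfolding OS_def continuous_map_in_subtopology continuous_map_componentwise
proof (intro conjI ballI)
  have bounds: "f z \<in> extensional (CX X)"
    "\<phi> \<in> CX X \<Longrightarrow> f z \<phi> \<in> {Inf (\<phi> ` topspace X) .. Sup (\<phi> ` topspace X)}"
    if "z \<in> topspace Z" for z \<phi>
    using assms(1)[OF that] by (auto simp: OS_set_def)
  show "f ` topspace Z \<subseteq> extensional (CX X)"
    using bounds by blast
  show "f \<in> topspace Z \<rightarrow> OS_set X"
    using assms by blast
  show "continuous_map Z euclideanreal (\<lambda>z. f z \<phi>)" if "\<phi> \<in> CX X" for \<phi>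
    using assms(2) that .
  show "(\<lambda>z. f z \<phi>) \<in> topspace Z \<rightarrow> {Inf (\<phi> ` topspace X) .. Sup (\<phi> ` topspace X)}"
    if "\<phi> \<in> CX X" for \<phi>
    using bounds(2) that by blast
qed

lemma continuous_map_OS_eval:
  assumes "\<phi> \<in> CX X"
  shows "continuous_map (OS X) euclideanreal (\<lambda>l. l \<phi>)"
  unfolding OS_def
  by (rule continuous_map_from_subtopology[OF continuous_map_into_fulltopology
      [OF continuous_map_product_projection[OF assms]]])

lemma closedin_Collect_Ball:
  assumes "\<And>i. i \<in> I \<Longrightarrow> closedin T {x \<in> topspace T. P i x}"
  shows "closedin T {x \<in> topspace T. \<forall>i\<in>I. P i x}"
proof -
  have eq: "{x \<in> topspace T. \<forall>i\<in>I. P i x} =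
      \<Inter> (insert (topspace T) ((\<lambda>i. {x \<in> topspace T. P i x}) ` I))"
    by auto
  show ?thesis
    unfolding eq by (rule closedin_Inter) (use assms in auto)
qed

lemma closedin_Collect_le_real:
  assumes "continuous_map T euclideanreal f" "continuous_map T euclideanreal g"
  shows "closedin T {x \<in> topspace T. f x \<le> g x}"
proof -
  have "continuous_map T euclideanreal (\<lambda>x. f x - g x)"
    by (intro continuous_intros assms)
  then have "closedin T {x \<in> topspace T. f x - g x \<in> {..0}}"
    by (rule closedin_continuous_map_preimage) auto
  then show ?thesis by (simp cong: conj_cong)
qed

lemma closedin_Collect_eq_real:
  assumes "continuous_map T euclideanreal f" "continuous_map T euclideanreal g"
  shows "closedin T {x \<in> topspace T. f x = g x}"
proof -
  have "{x \<in> topspace T. f x = g x} =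
      {x \<in> topspace T. f x \<le> g x} \<inter> {x \<in> topspace T. g x \<le> f x}"
    by auto
  then show ?thesis
    using assms by (simp add: closedin_Int closedin_Collect_le_real)
qed

text \<open>By Tychonoff the product of the closed intervals is compact, and the remaining
  conditions cut out a closed subset. Compactness of \<open>OS X\<close> is what later allows Dirac
  functionals over \<open>OS X\<close>.\<close>

lemma compact_space_OS: "compact_space (OS X)"
proof -
  define P where "P = product_topology (\<lambda>\<phi>. subtopology euclideanreal
         {Inf (\<phi> ` topspace X) .. Sup (\<phi> ` topspace X)}) (CX X)"
  have P: "compact_space P"
    unfolding P_def by (auto simp: compact_space_product_topology compact_space_subtopology)
  have ev: "continuous_map P euclideanreal (\<lambda>\<nu>. \<nu> \<phi>)" if "\<phi> \<in> CX X" for \<phi>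
    unfolding P_def
    by (rule continuous_map_into_fulltopology[OF continuous_map_product_projection[OF that]])
  have topP: "\<nu> \<in> topspace P \<longleftrightarrow> \<nu> \<in> extensional (CX X) \<and>
      (\<forall>\<phi>\<in>CX X. Inf (\<phi> ` topspace X) \<le> \<nu> \<phi> \<and> \<nu> \<phi> \<le> Sup (\<phi> ` topspace X))" for \<nu>
    by (auto simp: P_def PiE_iff)
  \<comment> \<open>Each clause becomes a family of equations or inequalities between coordinates.
    The premise of monotonicity does not involve \<open>\<nu>\<close>, so it moves into the index
    set of pairs.\<close>
  have "OS_set X =
     {\<nu> \<in> topspace P. \<nu> (constX X 1) = 1}
   \<inter> {\<nu> \<in> topspace P. \<forall>\<phi>\<in>CX X. \<forall>c\<in>UNIV. \<nu> (addX X \<phi> (constX X c)) = \<nu> \<phi> + c}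
   \<inter> {\<nu> \<in> topspace P. \<forall>p\<in>{(\<phi>,\<psi>). \<phi> \<in> CX X \<and> \<psi> \<in> CX X \<and> (\<forall>x\<in>topspace X. \<phi> x \<le> \<psi> x)}.
        \<nu> (fst p) \<le> \<nu> (snd p)}
   \<inter> {\<nu> \<in> topspace P. \<forall>\<phi>\<in>CX X. \<forall>t\<in>{0..}. \<nu> (scaleX X t \<phi>) = t * \<nu> \<phi>}
   \<inter> {\<nu> \<in> topspace P. \<forall>\<phi>\<in>CX X. \<forall>\<psi>\<in>CX X. \<nu> (addX X \<phi> \<psi>) \<le> \<nu> \<phi> + \<nu> \<psi>}"
    unfolding OS_set_def by (auto simp: topP)
  also have "closedin P \<dots>"
    by (intro closedin_Int closedin_Collect_Ball closedin_Collect_eq_real closedin_Collect_le_real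
        continuous_intros ev addX_in_CX constX_in_CX scaleX_in_CX) auto
  finally show ?thesis
    using P unfolding OS_def P_def[symmetric]
    by (simp add: closedin_compact_space compact_space_subtopology)
qed

section \<open>Point masses, maxima and averages of functionals\<close>

definition dirac :: "'a topology \<Rightarrow> 'a \<Rightarrow> ('a \<Rightarrow> real) \<Rightarrow> real" where
  "dirac X x = restrict (\<lambda>\<phi>. \<phi> x) (CX X)"

text \<open>Read functionals as support functions of closed convex sets of probability measures: the
  maximum represents the convex hull of the union, and \<open>os_avg\<close> below the Minkowski
  average.\<close>

definition os_max ::
  "'a topology \<Rightarrow> (('a \<Rightarrow> real) \<Rightarrow> real) \<Rightarrow> (('a \<Rightarrow> real) \<Rightarrow> real) \<Rightarrow> ('a \<Rightarrow> real) \<Rightarrow> real" where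
  "os_max X \<kappa> \<nu> = restrict (\<lambda>\<phi>. max (\<kappa> \<phi>) (\<nu> \<phi>)) (CX X)"

definition os_avg ::
  "'a topology \<Rightarrow> (('a \<Rightarrow> real) \<Rightarrow> real) \<Rightarrow> (('a \<Rightarrow> real) \<Rightarrow> real) \<Rightarrow> ('a \<Rightarrow> real) \<Rightarrow> real" where
  "os_avg X \<kappa> \<nu> = restrict (\<lambda>\<phi>. (\<kappa> \<phi> + \<nu> \<phi>) / 2) (CX X)"

lemma dirac_in_OS:
  assumes "compact_space X" "x \<in> topspace X"
  shows "dirac X x \<in> OS_set X"
  using assms(2) CX_bounds[OF assms(1) _ assms(2)] unfolding OS_set_def dirac_def
  by (simp add: addX_in_CX constX_in_CX scaleX_in_CX) (simp add: addX_def constX_def scaleX_def)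

lemma os_max_in_OS:
  assumes "\<kappa> \<in> OS_set X" "\<nu> \<in> OS_set X"
  shows "os_max X \<kappa> \<nu> \<in> OS_set X"
proof -
  note D = OS_setD[OF assms(1)] OS_setD[OF assms(2)]
  show ?thesis
    unfolding OS_set_def mem_Collect_eq
  proof (intro conjI ballI allI impI)
    fix \<phi> assume "\<phi> \<in> CX X"
    then show "Inf (\<phi> ` topspace X) \<le> os_max X \<kappa> \<nu> \<phi>" "os_max X \<kappa> \<nu> \<phi> \<le> Sup (\<phi> ` topspace X)"
      using assms by (fastforce simp: OS_set_def os_max_def)+
  next
    fix \<phi> \<psi> assume "\<phi> \<in> CX X" "\<psi> \<in> CX X" "\<forall>x\<in>topspace X. \<phi> x \<le> \<psi> x"
    then show "os_max X \<kappa> \<nu> \<phi> \<le> os_max X \<kappa> \<nu> \<psi>"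
      using D(3)[of \<phi> \<psi>] D(8)[of \<phi> \<psi>] by (auto simp: os_max_def)
  next
    fix \<phi> \<psi> assume "\<phi> \<in> CX X" "\<psi> \<in> CX X"
    then show "os_max X \<kappa> \<nu> (addX X \<phi> \<psi>) \<le> os_max X \<kappa> \<nu> \<phi> + os_max X \<kappa> \<nu> \<psi>"
      using D(5)[of \<phi> \<psi>] D(10)[of \<phi> \<psi>] by (auto simp: os_max_def addX_in_CX)
  qed (auto simp: os_max_def D addX_in_CX constX_in_CX scaleX_in_CX
      max_mult_distrib_left max_add_distrib_left)
qed


lemma os_avg_in_OS:
  assumes "\<kappa> \<in> OS_set X" "\<nu> \<in> OS_set X"
  shows "os_avg X \<kappa> \<nu> \<in> OS_set X"
proof -
  note D = OS_setD[OF assms(1)] OS_setD[OF assms(2)]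
  show ?thesis
    unfolding OS_set_def mem_Collect_eq
  proof (intro conjI ballI allI impI)
    fix \<phi> assume "\<phi> \<in> CX X"
    then show "Inf (\<phi> ` topspace X) \<le> os_avg X \<kappa> \<nu> \<phi>" "os_avg X \<kappa> \<nu> \<phi> \<le> Sup (\<phi> ` topspace X)"
      using assms by (fastforce simp: OS_set_def os_avg_def)+
  next
    fix \<phi> \<psi> assume "\<phi> \<in> CX X" "\<psi> \<in> CX X" "\<forall>x\<in>topspace X. \<phi> x \<le> \<psi> x"
    then show "os_avg X \<kappa> \<nu> \<phi> \<le> os_avg X \<kappa> \<nu> \<psi>"
      using D(3)[of \<phi> \<psi>] D(8)[of \<phi> \<psi>] by (simp add: os_avg_def)
  next
    fix \<phi> \<psi> assume "\<phi> \<in> CX X" "\<psi> \<in> CX X"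
    then show "os_avg X \<kappa> \<nu> (addX X \<phi> \<psi>) \<le> os_avg X \<kappa> \<nu> \<phi> + os_avg X \<kappa> \<nu> \<psi>"
      using D(5)[of \<phi> \<psi>] D(10)[of \<phi> \<psi>] by (simp add: os_avg_def addX_in_CX field_simps)
  qed (auto simp: os_avg_def D addX_in_CX constX_in_CX scaleX_in_CX field_simps)
qed

section \<open>Moving softness between types of test spaces\<close>

lemma softE:
  fixes Z :: "'z topology"
  assumes "soft TYPE('z) X Y f" "compactum Z" "closedin Z A"
    "continuous_map (subtopology Z A) X \<psi>" "continuous_map Z Y \<Psi>" "\<forall>a\<in>A. \<Psi> a = f (\<psi> a)"
  obtains G where "continuous_map Z X G" "\<forall>a\<in>A. G a = \<psi> a" "\<forall>z\<in>topspace Z. f (G z) = \<Psi> z"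
proof -
  have "\<exists>G. continuous_map Z X G \<and> (\<forall>a\<in>A. G a = \<psi> a) \<and> (\<forall>z\<in>topspace Z. f (G z) = \<Psi> z)"
    by (rule assms(1)[unfolded soft_def, rule_format]) (use assms(2-) in auto)
  then show thesis
    using that by blast
qed

text \<open>A test space on the smaller type has a homeomorphic copy along the injection; a lift
  found for the copy is composed with \<open>i\<close>.\<close>

lemma soft_inj_transfer:
  fixes i :: "'w \<Rightarrow> 'z"
  assumes "inj i" "soft TYPE('z) X Y f"
  shows "soft TYPE('w) X Y f"
  unfolding soft_def
proof (intro allI impI)
  fix Z :: "'w topology" and A \<psi> \<Psi>
  assume H: "compactum Z \<and> closedin Z A \<and> continuous_map (subtopology Z A) X \<psi>
      \<and> continuous_map Z Y \<Psi> \<and> (\<forall>a\<in>A. \<Psi> a = f (\<psi> a))"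
  define j where "j = inv i"
  have ji [simp]: "j (i w) = w" for w
    using assms(1) by (simp add: j_def)
  \<comment> \<open>The open sets of \<open>Z'\<close> are the preimages under \<open>j\<close>, cut
    down to \<open>range i\<close>, so \<open>i\<close> and \<open>j\<close> become mutually inverse
    homeomorphisms.\<close>
  define Z' where "Z' = pullback_topology (range i) j Z"
  have j: "continuous_map Z' Z j"
    using continuous_map_pullback[OF continuous_map_id, of "range i" j Z] by (simp add: Z'_def)
  have i: "continuous_map Z Z' i"
    unfolding Z'_def by (rule continuous_map_pullback') (auto simp: comp_def)
  have top: "topspace Z' = i ` topspace Z"
    by (auto simp: Z'_def topspace_pullback_topology)
  have hom: "homeomorphic_maps Z Z' i j"
    using i j by (auto simp: homeomorphic_maps_def top)
  then have "Z homeomorphic_space Z'"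
    by (auto simp: homeomorphic_space_def)
  then have "compactum Z'"
    using H homeomorphic_compact_space homeomorphic_Hausdorff_space unfolding compactum_def by blast
  moreover have "closedin Z' (i ` A)"
    using H hom homeomorphic_map_closedness_eq homeomorphic_maps_map by metis
  moreover have "continuous_map (subtopology Z' (i ` A)) X (\<psi> \<circ> j)"
  proof (rule continuous_map_compose)
    show "continuous_map (subtopology Z' (i ` A)) (subtopology Z A) j"
      using j by (auto simp: continuous_map_in_subtopology continuous_map_from_subtopology)
  qed (use H in auto)
  moreover have "continuous_map Z' Y (\<Psi> \<circ> j)"
    using H j continuous_map_compose by blast
  moreover have "\<forall>a\<in>i ` A. (\<Psi> \<circ> j) a = f ((\<psi> \<circ> j) a)"
    using H by auto
  ultimately obtain G where G: "continuous_map Z' X G" "\<forall>a\<in>i ` A. G a = (\<psi> \<circ> j) a"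
      "\<forall>z\<in>topspace Z'. f (G z) = (\<Psi> \<circ> j) z"
    by (rule softE[OF assms(2)])
  show "\<exists>G. continuous_map Z X G \<and> (\<forall>a\<in>A. G a = \<psi> a) \<and> (\<forall>z\<in>topspace Z. f (G z) = \<Psi> z)"
    using G by (intro exI[of _ "G \<circ> i"]) (auto simp: top intro: continuous_map_compose[OF i])
qed

lemma inj_eval: "inj (\<lambda>x (\<phi> :: 'a \<Rightarrow> real). \<phi> x)"
proof (rule injI)
  fix x y :: 'a
  assume "(\<lambda>\<phi> :: 'a \<Rightarrow> real. \<phi> x) = (\<lambda>\<phi>. \<phi> y)"
  then have "indicat_real {x} x = indicat_real {x} y"
    by (rule fun_cong)
  then show "x = y"
    by (auto simp: indicator_def split: if_splits)
qed

lemma inj_indicator_singleton: "inj (\<lambda>x :: 'a. indicat_real {x})"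
proof (rule injI)
  fix x y :: 'a
  assume "indicat_real {x} = indicat_real {y}"
  then have "indicat_real {x} x = indicat_real {y} x"
    by (rule fun_cong)
  then show "x = y"
    by (auto simp: indicator_def split: if_splits)
qed

section \<open>Separating functions and the isolated point argument\<close>

lemma CX_Urysohn:
  assumes "compactum X" "x \<in> topspace X" "closedin X T" "x \<notin> T"
  obtains u where "u \<in> CX X" "u x = 1" "\<And>t. t \<in> T \<Longrightarrow> u t = 0"
    "\<And>z. z \<in> topspace X \<Longrightarrow> 0 \<le> u z \<and> u z \<le> 1"
proof -
  have "closedin X {x}"
    using assms by (simp add: compactum_def closedin_Hausdorff_singleton)
  moreover have "normal_space X"
    using assms compact_Hausdorff_or_regular_imp_normal_space by (auto simp: compactum_def)
  ultimately obtain f where f: "continuous_map X (top_of_set {0..1::real}) f"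
      "f ` T \<subseteq> {0}" "f ` {x} \<subseteq> {1}"
    using assms(3,4) unfolding normal_space_iff_Urysohn by (metis disjnt_insert2 disjnt_empty2)
  show thesis
  proof
    show "restrict f (topspace X) \<in> CX X"
      using f by (intro restrict_in_CX) (auto simp: continuous_map_in_subtopology)
    show "restrict f (topspace X) x = 1"
      using f(3) assms(2) by simp
    show "restrict f (topspace X) t = 0" if "t \<in> T" for t
      using f(2) closedin_subset[OF assms(3)] that by auto
    show "0 \<le> restrict f (topspace X) z \<and> restrict f (topspace X) z \<le> 1"
      if "z \<in> topspace X" for z
      using continuous_map_image_subset_topspace[OF f(1)] that by auto
  qed
qed

lemma OS_eval_in_CX: "\<phi> \<in> CX X \<Longrightarrow> restrict (\<lambda>l. l \<phi>) (topspace (OS X)) \<in> CX (OS X)"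
  by (intro restrict_in_CX continuous_map_OS_eval)

lemma soft_muOS_imp_isolated_point:
  assumes X: "compactum X" and soft: "soft TYPE('a) (OS (OS X)) (OS X) (muOS X)"
    and x: "x \<in> topspace (X :: 'a topology)" and y: "y \<in> topspace X" and "x \<noteq> y"
  shows "openin X {x}"
proof -
  have comp: "compact_space X" and haus: "Hausdorff_space X"
    using X by (auto simp: compactum_def)
  obtain h where h: "h \<in> CX X" "h x = 1" "h y = 0"
      and h01: "\<And>z. z \<in> topspace X \<Longrightarrow> 0 \<le> h z \<and> h z \<le> 1"
  proof (rule CX_Urysohn[OF X x])
    show "closedin X {y}" "x \<notin> {y}"
      using \<open>x \<noteq> y\<close> y haus by (auto simp: closedin_Hausdorff_singleton)
  qed blast
  define nh where "nh = scaleX X (-1) h"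
  have nh: "nh \<in> CX X" "\<And>z. z \<in> topspace X \<Longrightarrow> nh z = - h z"
    using h by (auto simp: nh_def scaleX_in_CX) (simp add: scaleX_def)
  define ev where "ev \<phi> = restrict (\<lambda>l. l \<phi>) (topspace (OS X))" for \<phi>
  have ev: "ev \<phi> \<in> CX (OS X)" if "\<phi> \<in> CX X" for \<phi>
    using that by (simp add: ev_def OS_eval_in_CX)
  \<comment> \<open>\<open>- l nh\<close> is the minimum of \<open>h\<close> over the set of measures represented by \<open>l\<close>.\<close>
  define q where "q = restrict (\<lambda>l. - max 0 (1 + 2 * l nh)) (topspace (OS X))"
  have q: "q \<in> CX (OS X)"
    unfolding q_def by (intro restrict_in_CX continuous_intros continuous_map_OS_eval nh)
  define \<nu> where "\<nu> z = os_max X (dirac X x) (os_avg X (dirac X z) (dirac X y))" for z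
  have \<nu>_apply: "\<nu> z \<phi> = max (\<phi> x) ((\<phi> z + \<phi> y) / 2)" if "\<phi> \<in> CX X" for z \<phi>
    using that by (simp add: \<nu>_def os_max_def os_avg_def dirac_def)
  have "continuous_map X (OS X) \<nu>"
  proof (rule continuous_map_into_OS)
    fix \<phi> assume \<phi>: "\<phi> \<in> CX X"
    then have "continuous_map X euclideanreal \<phi>"
      by (simp add: CX_def)
    then show "continuous_map X euclideanreal (\<lambda>z. \<nu> z \<phi>)"
      unfolding \<nu>_apply[OF \<phi>] by (intro continuous_intros) auto
  qed (simp add: \<nu>_def os_max_in_OS os_avg_in_OS dirac_in_OS comp x y)
  moreover
  define N where "N = os_avg (OS X) (dirac (OS X) (dirac X x))
    (dirac (OS X) (os_max X (dirac X x) (dirac X y)))"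
  have in_OS: "dirac X x \<in> OS_set X" "os_max X (dirac X x) (dirac X y) \<in> OS_set X"
    by (simp_all add: os_max_in_OS dirac_in_OS comp x y)
  then have N: "N \<in> OS_set (OS X)"
    by (simp add: N_def os_avg_in_OS dirac_in_OS compact_space_OS topspace_OS)
  have N_apply: "N \<Phi> = (\<Phi> (dirac X x) + \<Phi> (os_max X (dirac X x) (dirac X y))) / 2"
    if "\<Phi> \<in> CX (OS X)" for \<Phi>
    using that by (simp add: N_def os_avg_def dirac_def)
  have "muOS X N = \<nu> x"
  proof (rule extensionalityI[of _ "CX X"])
    fix \<phi> assume \<phi>: "\<phi> \<in> CX X"
    then have "muOS X N \<phi> = (\<phi> x + max (\<phi> x) (\<phi> y)) / 2"
      using N_apply[OF ev[OF \<phi>]] in_OS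
      by (simp add: muOS_def ev_def topspace_OS) (simp add: dirac_def os_max_def)
    \<comment> \<open>The Minkowski identity on support functions: averaging the segment with its
      endpoint at \<open>x\<close> halves it.\<close>
    also have "\<dots> = max (\<phi> x) ((\<phi> x + \<phi> y) / 2)"
      by (simp add: max_def field_simps)
    finally show "muOS X N \<phi> = \<nu> x \<phi>"
      by (simp add: \<nu>_apply \<phi>)
  qed (auto simp: muOS_def \<nu>_def os_max_def)
  moreover have "closedin X {x}"
    by (simp add: closedin_Hausdorff_singleton haus x)
  moreover have "continuous_map (subtopology X {x}) (OS (OS X)) (\<lambda>_. N)"
    by (simp add: N topspace_OS)
  \<comment> \<open>The test space is \<open>X\<close> itself, with the lift prescribed only on the
    closed set \<open>{x}\<close>.\<close>
  ultimately obtain G where "continuous_map X (OS (OS X)) G" "\<forall>a\<in>{x}. G a = N"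
      "\<forall>z\<in>topspace X. muOS X (G z) = \<nu> z"
    using softE[OF soft X, of "{x}" "\<lambda>_. N" \<nu>] by auto
  then have G: "continuous_map X (OS (OS X)) G" "G x = N"
      and \<mu>G: "\<And>z. z \<in> topspace X \<Longrightarrow> muOS X (G z) = \<nu> z"
    by auto
  \<comment> \<open>The lifting condition fixes \<open>G z\<close> on evaluations only. Since
    \<open>q\<close> is not given as one, \<open>G z q\<close> will be bounded from below by
    semiadditivity.\<close>
  have G_ev: "G z (ev \<phi>) = max (\<phi> x) ((\<phi> z + \<phi> y) / 2)"
    if "z \<in> topspace X" "\<phi> \<in> CX X" for z \<phi>
  proof -
    have "G z (ev \<phi>) = muOS X (G z) \<phi>"
      using that by (simp add: muOS_def ev_def)
    then show ?thesis
      using that by (simp add: \<mu>G \<nu>_apply)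
  qed
  \<comment> \<open>If m is the minimum of \<open>h\<close> over the set represented by
    \<open>l\<close>, then \<open>q l\<close> is min(0, 2m - 1). It is 0 at the Dirac functional of
    \<open>x\<close>, where m = 1, and -1 at the segment reaching \<open>y\<close>, where m =
    0.\<close>
  have Nq: "N q = - (1/2)"
    using in_OS nh h x y by (simp add: N_apply q) (simp add: q_def topspace_OS dirac_def os_max_def)
  have Gq: "G z q \<ge> h z - 1" if z: "z \<in> topspace X" "z \<noteq> x" for z
  proof -
    have "closedin X {y, z}"
      using closedin_Un[of X "{y}" "{z}"] z y haus by (simp add: closedin_Hausdorff_singleton insert_commute)
    \<comment> \<open>Here \<open>z \<noteq> x\<close> is essential: \<open>u\<close> has to be 1 at
      \<open>x\<close> and 0 at \<open>z\<close>.\<close>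
    then obtain u where u: "u \<in> CX X" "u x = 1" "u y = 0" "u z = 0"
        and u01: "\<And>z. z \<in> topspace X \<Longrightarrow> 0 \<le> u z \<and> u z \<le> 1"
    proof (rule CX_Urysohn[OF X x])
      show "x \<notin> {y, z}"
        using z \<open>x \<noteq> y\<close> by auto
    qed blast
    \<comment> \<open>The function \<open>v\<close> is 2 - 2h, chosen so that \<open>l v\<close>
      exceeds the term 1 + 2 * \<open>l nh\<close> of \<open>q\<close> by exactly 1, an upper bound
      for \<open>l u\<close>.\<close>
    define v where "v = addX X (scaleX X 2 nh) (constX X 2)"
    have v: "v \<in> CX X" and v_apply: "\<And>w. w \<in> topspace X \<Longrightarrow> v w = 2 - 2 * h w"
      using nh by (auto simp: v_def addX_in_CX scaleX_in_CX constX_in_CX)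
        (simp add: addX_def scaleX_def constX_def)
    have uv: "addX X u v \<in> CX X"
      by (simp add: addX_in_CX u v)
    have uv_apply: "addX X u v w = u w + v w" if "w \<in> topspace X" for w
      using that by (simp add: addX_def)
    have GO: "G z \<in> OS_set (OS X)"
      using continuous_map_image_subset_topspace[OF G(1)] z by (auto simp: topspace_OS)
    \<comment> \<open>As \<open>u\<close> and \<open>v\<close> are nonnegative,
      \<open>l (addX X u v)\<close> dominates both \<open>l u\<close> and \<open>l v\<close>. The
      first bound settles the case \<open>q l = 0\<close>; the second, with
      \<open>l u \<le> 1\<close>, settles the other.\<close>
    have key: "ev u l \<le> addX (OS X) (ev (addX X u v)) q l" if "l \<in> topspace (OS X)" for l
    proof -
      have l: "l \<in> OS_set X"
        using that by (simp add: topspace_OS)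
      have "l u \<le> l (addX X u v)"
        by (rule OS_setD(3)[OF l u(1) uv]) (use h01 in \<open>force simp: uv_apply v_apply\<close>)
      moreover have "l v \<le> l (addX X u v)"
        by (rule OS_setD(3)[OF l v uv]) (use u01 in \<open>force simp: uv_apply\<close>)
      moreover have "l v = 2 * l nh + 2"
        by (simp add: v_def OS_setD(2,4)[OF l] scaleX_in_CX nh)
      moreover have "l u \<le> l (constX X 1)"
        by (rule OS_setD(3)[OF l u(1) constX_in_CX]) (use u01 in \<open>force simp: constX_def\<close>)
      ultimately have "l u \<le> l (addX X u v) - max 0 (1 + 2 * l nh)"
        using OS_setD(1)[OF l] by auto
      then show ?thesis
        using that by (simp add: ev_def q_def addX_def[of "OS X"])
    qed
    have "1 = G z (ev u)"
      using z u by (simp add: G_ev)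
    also have "\<dots> \<le> G z (addX (OS X) (ev (addX X u v)) q)"
      by (rule OS_setD(3)[OF GO ev[OF u(1)] addX_in_CX[OF ev[OF uv] q] key])
    also have "\<dots> \<le> G z (ev (addX X u v)) + G z q"
      by (rule OS_setD(5)[OF GO ev[OF uv] q])
    \<comment> \<open>The sum u + v equals 1 at \<open>x\<close>, 2 - 2h(z) at \<open>z\<close> and
      2 at \<open>y\<close>, so \<open>G_ev\<close> gives max(1, 2 - h(z)), and h(z) is at most
      1.\<close>
    also have "G z (ev (addX X u v)) = 2 - h z"
      using z x y h u h01[of z] by (simp add: G_ev uv uv_apply v_apply)
    finally show ?thesis by simp
  qed
  have "continuous_map X euclideanreal (\<lambda>z. G z q)"
    using continuous_map_compose[OF G(1) continuous_map_OS_eval[OF q]] by (simp add: comp_def)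
  moreover have "continuous_map X euclideanreal h"
    using h by (simp add: CX_def)
  ultimately have "continuous_map X euclideanreal (\<lambda>z. G z q - h z)"
    by (intro continuous_intros)
  then have "openin X {z \<in> topspace X. G z q - h z \<in> {..< -1}}"
    by (rule openin_continuous_map_preimage) auto
  \<comment> \<open>The difference is -1/2 - 1 = -3/2 at \<open>x\<close> and at least -1 elsewhere,
    so the threshold -1 singles out \<open>x\<close>.\<close>
  moreover have "{z \<in> topspace X. G z q - h z \<in> {..< -1}} = {x}"
    using Gq x h Nq G(2) by force
  ultimately show ?thesis by simp
qed

theorem theorem2:
  fixes X :: "'a topology"
  assumes "compactum X"
    and "soft TYPE((((('a \<Rightarrow> real) \<Rightarrow> real) \<Rightarrow> real) \<Rightarrow> real) \<Rightarrow> real)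
              (OS (OS X)) (OS X) (muOS X)"
  shows "metrizable_space X"
proof -
  \<comment> \<open>The given test type has five function layers over \<open>'a\<close>. Each use of
    \<open>inj_eval\<close> removes two and \<open>inj_indicator_singleton\<close> the last, so that
    \<open>X\<close> itself can serve as test space.\<close>
  have "soft TYPE('a \<Rightarrow> real) (OS (OS X)) (OS X) (muOS X)"
    by (rule soft_inj_transfer[OF inj_eval soft_inj_transfer[OF inj_eval assms(2)]])
  then have soft: "soft TYPE('a) (OS (OS X)) (OS X) (muOS X)"
    by (rule soft_inj_transfer[OF inj_indicator_singleton])
  have "openin X {x}" if x: "x \<in> topspace X" for x
  \<comment> \<open>The isolated point argument needs a second point \<open>y\<close>; a one-point
    space is handled directly.\<close>
  proof (cases "topspace X = {x}")
    case True
    then show ?thesis by (metis openin_topspace)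
  next
    case False
    then show ?thesis
      using soft_muOS_imp_isolated_point[OF assms(1) soft x] x by blast
  qed
  then have "X = discrete_topology (topspace X)"
    by (metis discrete_topology_unique)
  then show ?thesis
    by (metis metrizable_space_discrete_topology)
qed

end
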